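(* Let $\beta = \beta_{i_1} * \beta_{i_2} * \cdots * \beta_{i_\ell}$ be a Dirichlet convolution of functions $\beta_j = \chi_{N_j}$, where $\chi_{N_j}$ denotes the characteristic function of the interval $[N_j, (1+\rho)N_j)$ with $\rho = X^{-\varpi}$, $\varpi = 1/1168$, and let $N = N_{i_1} N_{i_2} \cdots N_{i_\ell}$ satisfy $X^{3/8+8\varpi} < N \ll X^{1/2}$. Assume $R \le X^{-\varpi/6} N$. Then for any $q \ge 1$ we have \begin{equation*} \sum_{r\sim R}\ \sum_{\substack{\ell=1\\ (\ell,r)=1}}^{r} \left( \sum_{\substack{n\equiv \ell \ (\mathrm{mod}\ r)\\ (n,q)=1}} \beta(n) - \frac{1}{\varphi(r)} \sum_{(n,qr)=1} \beta(n) \right)^2 \ll \tau(q)^B N^2 X^{-\frac{\varpi}{12}}. \end{equation*}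
   Context: Here $X$ is a large real number, $r\sim R$ means $R\le r<2R$, $\tau$ is the divisor function, $\varphi$ is Euler's totient function, and $B$ denotes some positive constant. The inner sum over $\ell$ runs over reduced residue classes modulo $r$. *)

theory Defs
  imports "HOL-Analysis.Infinite_Sum" "HOL-Number_Theory.Totient" "HOL-Number_Theory.Cong"
begin

definition varpi :: real where
  "varpi = 1 / 1168"

definition divisor_tau :: "nat \<Rightarrow> nat" where
  "divisor_tau n = card {d. d dvd n}"

text \<open>Arithmetic functions are used on positive arguments only; at \<open>n = 0\<close> the index set below is
  infinite, so the value there is \<open>0\<close>.\<close>

definition dconv :: "(nat \<Rightarrow> real) \<Rightarrow> (nat \<Rightarrow> real) \<Rightarrow> nat \<Rightarrow> real" where
  "dconv f g n = (\<Sum>d | d dvd n. f d * g (n div d))"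

definition dconv_unit :: "nat \<Rightarrow> real" where
  "dconv_unit n = (if n = 1 then 1 else 0)"

definition dconv_list :: "(nat \<Rightarrow> real) list \<Rightarrow> nat \<Rightarrow> real" where
  "dconv_list fs = foldr dconv fs dconv_unit"

definition interval_char :: "real \<Rightarrow> real \<Rightarrow> nat \<Rightarrow> real" where
  "interval_char \<rho> M = (\<lambda>n. indicator {M..<(1 + \<rho>) * M} (real n))"

definition dyadic :: "real \<Rightarrow> nat set" where
  "dyadic R = {r. R \<le> real r \<and> real r < 2 * R}"

text \<open>The sums over \<open>n\<close> range over all positive integers; they are applied to finitely
  supported \<open>\<beta>\<close>, so the infinite sums below are in fact finite.\<close>

definition discrepancy :: "(nat \<Rightarrow> real) \<Rightarrow> nat \<Rightarrow> nat \<Rightarrow> nat \<Rightarrow> real" where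
  "discrepancy \<beta> q r a =
     (\<Sum>\<^sub>\<infinity>n | 0 < n \<and> [n = a] (mod r) \<and> coprime n q. \<beta> n)
     - 1 / real (totient r) * (\<Sum>\<^sub>\<infinity>n | 0 < n \<and> coprime n (q * r). \<beta> n)"

end

theory Submission
  imports Defs
begin

text \<open>Each interval has relative length \<open>\<rho> = X\<^bsup>-\<varpi>\<^esup>\<close>, so the total mass \<open>S\<close> of \<open>\<beta>\<close> is already
  \<open>O(X\<^bsup>-\<varpi>\<^esup> N)\<close> and no large sieve is needed.  The inner sum over residue classes is a variance,
  hence at most the sum of \<open>\<beta>(n) \<beta>(m)\<close> over \<open>n \<equiv> m (mod r)\<close>.  Summing over \<open>r \<sim> R\<close>, the diagonal
  contributes at most \<open>2 R S max \<beta>\<close>, and each pair \<open>n \<noteq> m\<close> is counted at most \<open>\<tau>(|n - m|)\<close> times.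
  The divisor bound then gives \<open>O(X\<^bsup>\<varpi>/2\<^esup> (R S + S\<^sup>2))\<close>, with \<open>B = 1\<close>.\<close>

section \<open>The divisor bound\<close>

lemma divisor_tau_pos: "0 < n \<Longrightarrow> 0 < divisor_tau n"
  by (auto simp: divisor_tau_def card_gt_0_iff)

lemma divisor_tau_mono: "m dvd n \<Longrightarrow> 0 < n \<Longrightarrow> divisor_tau m \<le> divisor_tau n"
  unfolding divisor_tau_def by (intro card_mono) (auto intro: dvd_trans)

lemma divisor_tau_mult_le: "divisor_tau (a * b) \<le> divisor_tau a * divisor_tau b"
proof (cases "a * b = 0")
  case False
  have "{d. d dvd a * b} \<subseteq> (\<lambda>(x, y). x * y) ` ({d. d dvd a} \<times> {d. d dvd b})"
  proof
    fix d assume "d \<in> {d. d dvd a * b}"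
    then obtain x y where "d = x * y" "x dvd a" "y dvd b"
      using division_decomp[of d a b] by auto
    then show "d \<in> (\<lambda>(x, y). x * y) ` ({d. d dvd a} \<times> {d. d dvd b})"
      by (intro image_eqI[of _ _ "(x, y)"]) auto
  qed
  then have "card {d. d dvd a * b} \<le> card ({d. d dvd a} \<times> {d. d dvd b})"
    using False by (intro surj_card_le) auto
  then show ?thesis
    by (simp add: divisor_tau_def card_cartesian_product)
qed (auto simp: divisor_tau_def)

lemma divisor_tau_prod_le: "divisor_tau (\<Prod>x\<in>A. f x) \<le> (\<Prod>x\<in>A. divisor_tau (f x))"
proof (induction A rule: infinite_finite_induct)
  case (insert x A)
  have "divisor_tau (f x * (\<Prod>x\<in>A. f x)) \<le> divisor_tau (f x) * divisor_tau (\<Prod>x\<in>A. f x)"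
    by (rule divisor_tau_mult_le)
  also have "\<dots> \<le> divisor_tau (f x) * (\<Prod>x\<in>A. divisor_tau (f x))"
    using insert.IH by (rule mult_left_mono) simp
  finally show ?case
    using insert.hyps by simp
qed (simp_all add: divisor_tau_def)

lemma divisor_tau_prime_power:
  assumes "prime p"
  shows "divisor_tau (p ^ a) = Suc a"
proof -
  have "{d. d dvd p ^ a} = (\<lambda>i. p ^ i) ` {..a}"
    using divides_primepow_nat[OF assms] by auto
  moreover have "inj_on (\<lambda>i. p ^ i) {..a}"
    using prime_gt_1_nat[OF assms] by (auto intro: inj_onI)
  ultimately show ?thesis
    by (simp add: divisor_tau_def card_image)
qed

lemma divisor_tau_le_prod_multiplicity:
  assumes "0 < n"
  shows "divisor_tau n \<le> (\<Prod>p\<in>prime_factors n. Suc (multiplicity p n))"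
proof -
  have "divisor_tau n = divisor_tau (\<Prod>p\<in>prime_factors n. p ^ multiplicity p n)"
    using assms by (simp add: prod_prime_factors)
  also have "\<dots> \<le> (\<Prod>p\<in>prime_factors n. divisor_tau (p ^ multiplicity p n))"
    by (rule divisor_tau_prod_le)
  also have "\<dots> = (\<Prod>p\<in>prime_factors n. Suc (multiplicity p n))"
    by (intro prod.cong refl divisor_tau_prime_power) auto
  finally show ?thesis .
qed

lemma Suc_le_mult_power_powr:
  fixes x e :: real
  assumes "2 \<le> x" "0 < e"
  shows "real (Suc a) \<le> max 1 (1 / (e * ln 2)) * (x ^ a) powr e"
proof -
  let ?C = "max 1 (1 / (e * ln 2))"
  have C: "1 \<le> ?C" "1 \<le> ?C * (e * ln 2)"
    using assms(2) by (auto simp: max_def field_simps)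
  have "real (Suc a) \<le> ?C * 1 + ?C * (e * ln 2) * a"
    using C mult_right_mono[OF C(2), of "real a"] by simp
  also have "\<dots> = ?C * (1 + e * a * ln 2)"
    by (simp add: algebra_simps)
  also have "\<dots> \<le> ?C * (1 + e * a * ln x)"
    using assms C by (intro mult_left_mono add_left_mono) auto
  also have "\<dots> \<le> ?C * exp (e * a * ln x)"
    using C by (intro mult_left_mono exp_ge_add_one_self) auto
  also have "exp (e * a * ln x) = (x ^ a) powr e"
    using assms by (simp add: powr_def ln_realpow)
  finally show ?thesis .
qed

lemma Suc_le_power_powr:
  fixes x e :: real
  assumes "2 \<le> x powr e"
  shows "real (Suc a) \<le> (x ^ a) powr e"
proof -
  have "real (Suc a) \<le> 2 ^ a"
    by (metis Suc_leI less_exp of_nat_le_iff of_nat_numeral of_nat_power)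
  also have "\<dots> \<le> (x powr e) ^ a"
    using assms by (intro power_mono) auto
  also have "\<dots> = (x ^ a) powr e"
    by (induction a) (use assms in \<open>auto simp: powr_mult\<close>)
  finally show ?thesis .
qed

lemma finite_nat_real_less: "finite {n::nat. real n < b}"
  by (rule finite_subset[of _ "{..<nat \<lceil>b\<rceil>}"]) (auto simp: less_ceiling_iff zless_nat_eq_int_zless)

lemma finite_nat_powr_less:
  assumes "0 < e"
  shows "finite {n::nat. real n powr e < b}"
proof (rule finite_subset[OF _ finite_nat_real_less])
  show "{n::nat. real n powr e < b} \<subseteq> {n. real n < b powr (1 / e)}"
  proof
    fix n :: nat assume "n \<in> {n. real n powr e < b}"
    then have "(real n powr e) powr (1 / e) < b powr (1 / e)"
      using assms by (intro powr_less_mono2) auto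
    then show "n \<in> {n. real n < b powr (1 / e)}"
      using assms by (simp add: powr_powr)
  qed
qed

text \<open>In \<open>\<tau>(n) / n\<^sup>e\<close> a prime \<open>p\<close> contributes at most \<open>1\<close> as soon as \<open>p\<^sup>e \<ge> 2\<close>, and a bounded factor
  otherwise.\<close>

lemma divisor_tau_le_card_small_primes:
  fixes n :: nat
  assumes "0 < e" "0 < n"
  shows "real (divisor_tau n)
    \<le> max 1 (1 / (e * ln 2)) ^ card {p \<in> prime_factors n. real p powr e < 2} * n powr e"
proof -
  let ?F = "prime_factors n" and ?C = "max 1 (1 / (e * ln 2)) :: real"
  let ?f = "\<lambda>p. real p ^ multiplicity p n"
  have "real (divisor_tau n) \<le> (\<Prod>p\<in>?F. real (Suc (multiplicity p n)))"
    using divisor_tau_le_prod_multiplicity[OF assms(2)]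
    by (simp only: flip: of_nat_prod of_nat_le_iff)
  also have "\<dots> \<le> (\<Prod>p\<in>?F. (if real p powr e < 2 then ?C else 1) * ?f p powr e)"
  proof (intro prod_mono conjI)
    fix p assume "p \<in> ?F"
    then have "2 \<le> real p"
      using prime_ge_2_nat[of p] by auto
    then show "real (Suc (multiplicity p n)) \<le> (if real p powr e < 2 then ?C else 1) * ?f p powr e"
      using Suc_le_mult_power_powr[of "real p" e] Suc_le_power_powr[of "real p" e] assms(1) by simp
  qed simp
  also have "\<dots> = (\<Prod>p\<in>?F. if real p powr e < 2 then ?C else 1) * (\<Prod>p\<in>?F. ?f p) powr e"
    by (simp add: prod.distrib prod_powr_distrib)
  also have "(\<Prod>p\<in>?F. ?f p) = real n"
    using assms(2) by (simp add: prod_prime_factors flip: of_nat_power of_nat_prod)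
  also have "(\<Prod>p\<in>?F. if real p powr e < 2 then ?C else 1) = ?C ^ card {p \<in> ?F. real p powr e < 2}"
    by (simp add: prod.If_cases Int_def)
  finally show ?thesis .
qed

lemma divisor_bound:
  fixes e :: real
  assumes "0 < e"
  obtains C where "0 < C" "\<And>n. 0 < n \<Longrightarrow> real (divisor_tau n) \<le> C * n powr e"
proof
  let ?C = "max 1 (1 / (e * ln 2))" and ?P = "{p::nat. real p powr e < 2}"
  show "0 < ?C ^ card ?P"
    by simp
  fix n :: nat assume n: "0 < n"
  have "real (divisor_tau n) \<le> ?C ^ card {p \<in> prime_factors n. real p powr e < 2} * n powr e"
    using assms n by (rule divisor_tau_le_card_small_primes)
  also have "\<dots> \<le> ?C ^ card ?P * n powr e"
    using finite_nat_powr_less[OF assms]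
    by (intro mult_right_mono power_increasing card_mono) auto
  finally show "real (divisor_tau n) \<le> ?C ^ card ?P * n powr e" .
qed

lemma divisor_tau_power_bound:
  fixes \<delta> :: real
  assumes "0 < \<delta>" "0 < k"
  obtains C where "0 < C" "\<And>n. 0 < n \<Longrightarrow> real (divisor_tau n) ^ k \<le> C * n powr \<delta>"
proof -
  have "0 < \<delta> / real k"
    using assms by simp
  from divisor_bound[OF this] obtain C where C: "0 < C"
      "\<And>n. 0 < n \<Longrightarrow> real (divisor_tau n) \<le> C * n powr (\<delta> / k)"
    by blast
  show thesis
  proof
    show "0 < C ^ k"
      using C(1) by simp
    fix n :: nat assume n: "0 < n"
    have "real (divisor_tau n) ^ k \<le> (C * n powr (\<delta> / k)) ^ k"
      using C(2)[OF n] by (rule power_mono) simp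
    also have "\<dots> = C ^ k * n powr \<delta>"
      using assms n by (simp add: power_mult_distrib powr_power)
    finally show "real (divisor_tau n) ^ k \<le> C ^ k * n powr \<delta>" .
  qed
qed

section \<open>Dirichlet convolutions of nonnegative functions\<close>

lemma dconv_list_Nil: "dconv_list [] = dconv_unit"
  by (simp add: dconv_list_def)

lemma dconv_list_Cons: "dconv_list (f # fs) = dconv f (dconv_list fs)"
  by (simp add: dconv_list_def)

lemma dconv_list_0: "dconv_list fs 0 = 0"
  by (cases fs) (simp_all add: dconv_list_Nil dconv_list_Cons dconv_unit_def dconv_def)

lemma dconv_list_nonneg:
  assumes "\<And>f n. f \<in> set fs \<Longrightarrow> 0 \<le> f n"
  shows "0 \<le> dconv_list fs n"
  using assms
  by (induction fs arbitrary: n)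
     (auto simp: dconv_list_Nil dconv_list_Cons dconv_unit_def dconv_def intro!: sum_nonneg)

lemma dconv_list_le_divisor_tau_power:
  assumes "\<And>f n. f \<in> set fs \<Longrightarrow> 0 \<le> f n \<and> f n \<le> 1" "0 < n"
  shows "dconv_list fs n \<le> real (divisor_tau n) ^ length fs"
  using assms
proof (induction fs arbitrary: n)
  case Nil
  then show ?case by (simp add: dconv_list_Nil dconv_unit_def)
next
  case (Cons f fs)
  have "dconv_list (f # fs) n \<le> (\<Sum>d | d dvd n. real (divisor_tau n) ^ length fs)"
    unfolding dconv_list_Cons dconv_def
  proof (rule sum_mono)
    fix d assume "d \<in> {d. d dvd n}"
    then have pos: "0 < n div d" and dvd: "n div d dvd n"
      using Cons.prems(2) by (auto simp: dvd_div_eq_0_iff elim: dvdE)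
    have "f d * dconv_list fs (n div d) \<le> 1 * dconv_list fs (n div d)"
      using Cons.prems(1) by (intro mult_right_mono dconv_list_nonneg) auto
    also have "\<dots> \<le> real (divisor_tau (n div d)) ^ length fs"
      using Cons.IH[OF _ pos] Cons.prems(1) by simp
    also have "\<dots> \<le> real (divisor_tau n) ^ length fs"
      using divisor_tau_mono[OF dvd Cons.prems(2)] by (intro power_mono) auto
    finally show "f d * dconv_list fs (n div d) \<le> real (divisor_tau n) ^ length fs" .
  qed
  then show ?case
    by (simp add: divisor_tau_def)
qed

lemma dconv_list_support_le:
  assumes "\<And>x n. x \<in> set xs \<Longrightarrow> f x n \<noteq> 0 \<Longrightarrow> real n \<le> M x"
    and "dconv_list (map f xs) n \<noteq> 0"
  shows "real n \<le> (\<Prod>x\<leftarrow>xs. M x)"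
  using assms
proof (induction xs arbitrary: n)
  case Nil
  then show ?case by (auto simp: dconv_list_Nil dconv_unit_def split: if_splits)
next
  case (Cons x xs)
  from Cons.prems(2) obtain d where d: "d dvd n" "f x d \<noteq> 0"
      "dconv_list (map f xs) (n div d) \<noteq> 0"
    by (auto simp: dconv_list_Cons dconv_def elim!: sum.not_neutral_contains_not_neutral)
  have "real d \<le> M x"
    using Cons.prems(1) d(2) by simp
  moreover have "real (n div d) \<le> (\<Prod>x\<leftarrow>xs. M x)"
    using Cons.IH[OF _ d(3)] Cons.prems(1) by simp
  ultimately have "real d * real (n div d) \<le> M x * (\<Prod>x\<leftarrow>xs. M x)"
    by (intro mult_mono) auto
  then show ?case
    using d(1) by (simp flip: of_nat_mult)
qed

lemma sum_dconv_le:
  assumes "\<And>n. 0 \<le> f n" "\<And>n. 0 \<le> g n"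
  shows "(\<Sum>n\<in>{1..Y}. dconv f g n) \<le> (\<Sum>n\<in>{1..Y}. f n) * (\<Sum>n\<in>{1..Y}. g n)"
proof -
  let ?D = "SIGMA n:{1..Y}. {d. d dvd n}"
  let ?\<pi> = "\<lambda>(n::nat, d). (d, n div d)"
  have inj: "inj_on ?\<pi> ?D"
    by (rule inj_onI) (auto elim!: dvdE)
  have "?\<pi> ` ?D \<subseteq> {1..Y} \<times> {1..Y}"
  proof clarsimp
    fix n d :: nat assume nd: "Suc 0 \<le> n" "n \<le> Y" "d dvd n"
    then have "0 < n div d" "0 < d" "d \<le> n"
      by (auto simp: dvd_div_eq_0_iff dvd_imp_le elim: dvdE)
    moreover have "n div d \<le> Y"
      using div_le_dividend[of n d] nd(2) by (rule le_trans)
    ultimately show "Suc 0 \<le> d \<and> d \<le> Y \<and> Suc 0 \<le> n div d \<and> n div d \<le> Y"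
      using nd by simp
  qed
  then have "(\<Sum>(d, e)\<in>?\<pi> ` ?D. f d * g e) \<le> (\<Sum>(d, e)\<in>{1..Y} \<times> {1..Y}. f d * g e)"
    using assms by (intro sum_mono2) auto
  moreover have "(\<Sum>n\<in>{1..Y}. dconv f g n) = (\<Sum>(n, d)\<in>?D. f d * g (n div d))"
    unfolding dconv_def by (subst sum.Sigma) auto
  moreover have "\<dots> = (\<Sum>(d, e)\<in>?\<pi> ` ?D. f d * g e)"
    by (subst sum.reindex[OF inj]) (auto intro!: sum.cong)
  ultimately show ?thesis
    by (simp add: sum_product sum.cartesian_product)
qed

lemma sum_dconv_list_le:
  assumes "\<And>f n. f \<in> set fs \<Longrightarrow> 0 \<le> f n"
  shows "(\<Sum>n\<in>{1..Y}. dconv_list fs n) \<le> (\<Prod>f\<leftarrow>fs. \<Sum>n\<in>{1..Y}. f n)"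
  using assms
proof (induction fs)
  case Nil
  have "(\<Sum>n\<in>{1..Y}. dconv_list [] n) = (if 1 \<in> {1..Y} then 1 else 0)"
    by (simp add: dconv_list_Nil dconv_unit_def)
  then show ?case by simp
next
  case (Cons f fs)
  have "(\<Sum>n\<in>{1..Y}. dconv_list (f # fs) n) \<le> (\<Sum>n\<in>{1..Y}. f n) * (\<Sum>n\<in>{1..Y}. dconv_list fs n)"
    unfolding dconv_list_Cons using Cons.prems by (intro sum_dconv_le dconv_list_nonneg) auto
  also have "\<dots> \<le> (\<Sum>n\<in>{1..Y}. f n) * (\<Prod>f\<leftarrow>fs. \<Sum>n\<in>{1..Y}. f n)"
    using Cons by (intro mult_left_mono sum_nonneg) auto
  finally show ?case by simp
qed

section \<open>Convolutions of short intervals\<close>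

lemma card_pos_nat_less_le:
  assumes "0 \<le> b"
  shows "real (card {n::nat. 0 < n \<and> real n < b}) \<le> b"
proof -
  have "{n::nat. 0 < n \<and> real n < b} = {1..<nat \<lceil>b\<rceil>}"
    by (auto simp: less_ceiling_iff zless_nat_eq_int_zless)
  then show ?thesis
    using assms by simp linarith
qed

lemma card_nat_real_interval_le:
  assumes "0 \<le> a" "a \<le> b"
  shows "real (card {n::nat. a \<le> real n \<and> real n < b}) \<le> b - a + 1"
proof -
  have "{n::nat. a \<le> real n \<and> real n < b} = {nat \<lceil>a\<rceil>..<nat \<lceil>b\<rceil>}"
    by (auto simp: less_ceiling_iff ceiling_le_iff zless_nat_eq_int_zless nat_le_iff)
  then show ?thesis
    using assms by simp linarith
qed

lemma interval_char_bounds: "0 \<le> interval_char \<rho> M n" "interval_char \<rho> M n \<le> 1"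
  by (auto simp: interval_char_def indicator_def)

lemma interval_char_support_le:
  assumes "interval_char \<rho> M n \<noteq> 0" "\<rho> \<le> 1" "0 < M"
  shows "real n \<le> 2 * M"
proof -
  have "real n < (1 + \<rho>) * M"
    using assms(1) by (auto simp: interval_char_def indicator_def split: if_splits)
  also have "\<dots> \<le> 2 * M"
    using assms(2,3) by (intro mult_right_mono) auto
  finally show ?thesis by simp
qed

abbreviation (input) interval_conv :: "real \<Rightarrow> ('a \<Rightarrow> real) \<Rightarrow> 'a list \<Rightarrow> nat \<Rightarrow> real" where
  "interval_conv \<rho> M xs \<equiv> dconv_list (map (\<lambda>x. interval_char \<rho> (M x)) xs)"

lemma interval_conv_nonneg: "0 \<le> interval_conv \<rho> M xs n"
  by (intro dconv_list_nonneg) (auto simp: interval_char_bounds)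

lemma interval_conv_le_divisor_tau_power:
  assumes "0 < n"
  shows "interval_conv \<rho> M xs n \<le> real (divisor_tau n) ^ length xs"
  using dconv_list_le_divisor_tau_power[of "map (\<lambda>x. interval_char \<rho> (M x)) xs" n] assms
    interval_char_bounds by fastforce

lemma interval_conv_support:
  assumes "\<And>x. x \<in> set xs \<Longrightarrow> 0 < M x" "\<rho> \<le> 1"
    and "interval_conv \<rho> M xs n \<noteq> 0"
  shows "n \<in> {1..nat \<lfloor>2 ^ length xs * (\<Prod>x\<leftarrow>xs. M x)\<rfloor>}"
proof -
  have "n \<noteq> 0"
    using assms(3) by (auto simp: dconv_list_0 intro: ccontr)
  moreover have "real n \<le> (\<Prod>x\<leftarrow>xs. 2 * M x)"
    using assms by (intro dconv_list_support_le) (auto intro: interval_char_support_le)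
  moreover have "(\<Prod>x\<leftarrow>xs. 2 * M x) = 2 ^ length xs * (\<Prod>x\<leftarrow>xs. M x)"
    by (induction xs) auto
  ultimately show ?thesis
    by (simp add: le_nat_iff le_floor_iff)
qed

text \<open>Twice this quantity bounds the number of positive integers in \<open>[M, (1 + \<rho>) M)\<close>.  The cap by
  \<open>M\<close>, relevant only for \<open>M < 1\<close>, makes it supermultiplicative.\<close>

definition interval_size :: "real \<Rightarrow> real \<Rightarrow> real" where
  "interval_size \<rho> M = min M (max 1 (\<rho> * M))"

lemma interval_size_nonneg: "0 \<le> M \<Longrightarrow> 0 \<le> interval_size \<rho> M"
  by (simp add: interval_size_def)

lemma interval_size_mult_le:
  assumes "0 \<le> \<rho>" "0 \<le> x" "0 \<le> y"
  shows "interval_size \<rho> x * interval_size \<rho> y \<le> interval_size \<rho> (x * y)"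
proof -
  have nonneg: "0 \<le> interval_size \<rho> x" "0 \<le> interval_size \<rho> y"
    using assms by (simp_all add: interval_size_nonneg)
  have le_self: "interval_size \<rho> x \<le> x" "interval_size \<rho> y \<le> y"
    by (simp_all add: interval_size_def)
  have "interval_size \<rho> x * interval_size \<rho> y \<le> x * y"
    using nonneg le_self assms by (intro mult_mono) auto
  moreover have "interval_size \<rho> x * interval_size \<rho> y \<le> max 1 (\<rho> * (x * y))"
  proof -
    consider (long_x) "1 \<le> \<rho> * x" | (long_y) "1 \<le> \<rho> * y" | (short) "\<rho> * x \<le> 1" "\<rho> * y \<le> 1"
      by linarith
    then show ?thesis
    proof cases
      case long_x
      then have "interval_size \<rho> x * interval_size \<rho> y \<le> (\<rho> * x) * y"
        using nonneg le_self assms by (intro mult_mono) (auto simp: interval_size_def)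
      then show ?thesis by (simp add: mult_ac)
    next
      case long_y
      then have "interval_size \<rho> x * interval_size \<rho> y \<le> x * (\<rho> * y)"
        using nonneg le_self assms by (intro mult_mono) (auto simp: interval_size_def)
      then show ?thesis by (simp add: mult_ac)
    next
      case short
      then have "interval_size \<rho> x * interval_size \<rho> y \<le> 1"
        using nonneg by (intro mult_le_one) (auto simp: interval_size_def)
      then show ?thesis by simp
    qed
  qed
  ultimately show ?thesis
    by (simp add: interval_size_def[of \<rho> "x * y"])
qed

lemma sum_interval_char_le:
  assumes "0 < M" "0 \<le> \<rho>" "\<rho> \<le> 1"
  shows "(\<Sum>n\<in>{1..Y}. interval_char \<rho> M n) \<le> 2 * interval_size \<rho> M"
proof -
  let ?A = "{n \<in> {1..Y}. M \<le> real n \<and> real n < (1 + \<rho>) * M}"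
  have \<rho>M: "0 \<le> \<rho> * M" "\<rho> * M \<le> M"
    using assms by (auto simp: mult_le_cancel_right1)
  have "real (card ?A) \<le> real (card {n::nat. 0 < n \<and> real n < (1 + \<rho>) * M})"
    by (intro of_nat_mono card_mono finite_subset[OF _ finite_nat_real_less]) auto
  also have "\<dots> \<le> (1 + \<rho>) * M"
    using assms by (intro card_pos_nat_less_le) auto
  finally have "real (card ?A) \<le> 2 * M"
    using \<rho>M by (simp add: algebra_simps)
  moreover have "real (card ?A) \<le> real (card {n::nat. M \<le> real n \<and> real n < (1 + \<rho>) * M})"
    by (intro of_nat_mono card_mono finite_subset[OF _ finite_nat_real_less]) auto
  moreover have "\<dots> \<le> (1 + \<rho>) * M - M + 1"
    using assms \<rho>M by (intro card_nat_real_interval_le) (auto simp: algebra_simps)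
  ultimately have "real (card ?A) \<le> 2 * interval_size \<rho> M"
    by (auto simp: interval_size_def algebra_simps)
  moreover have "(\<Sum>n\<in>{1..Y}. interval_char \<rho> M n) = real (card ?A)"
    by (simp add: interval_char_def indicator_def sum.If_cases Int_def)
  ultimately show ?thesis by simp
qed

lemma prod_sum_interval_char_le:
  assumes "\<And>x. x \<in> set xs \<Longrightarrow> 0 < M x" "0 \<le> \<rho>" "\<rho> \<le> 1"
  shows "(\<Prod>x\<leftarrow>xs. \<Sum>n\<in>{1..Y}. interval_char \<rho> (M x) n)
    \<le> 2 ^ length xs * interval_size \<rho> (\<Prod>x\<leftarrow>xs. M x)"
  using assms(1)
proof (induction xs)
  case Nil
  then show ?case by (simp add: interval_size_def)
next
  case (Cons x xs)
  let ?S = "\<lambda>x. \<Sum>n\<in>{1..Y}. interval_char \<rho> (M x) n"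
  let ?N = "\<Prod>x\<leftarrow>xs. M x"
  have N: "0 \<le> ?N"
    using Cons.prems by (intro prod_list_nonneg) (auto intro: less_imp_le)
  have S: "0 \<le> ?S x" for x
    by (intro sum_nonneg interval_char_bounds)
  have "?S x * (\<Prod>x\<leftarrow>xs. ?S x)
      \<le> (2 * interval_size \<rho> (M x)) * (2 ^ length xs * interval_size \<rho> ?N)"
    using Cons assms(2,3) S
    by (intro mult_mono sum_interval_char_le prod_list_nonneg)
       (auto simp: interval_size_nonneg less_imp_le)
  also have "\<dots> \<le> 2 ^ length (x # xs) * interval_size \<rho> (M x * ?N)"
    using interval_size_mult_le[OF assms(2) _ N, of "M x"] Cons.prems by (simp add: less_imp_le)
  finally show ?case by simp
qed

lemma sum_interval_conv_le:
  assumes "\<And>x. x \<in> set xs \<Longrightarrow> 0 < M x" "0 \<le> \<rho>" "\<rho> \<le> 1" "1 \<le> \<rho> * (\<Prod>x\<leftarrow>xs. M x)"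
  shows "(\<Sum>n\<in>{1..Y}. interval_conv \<rho> M xs n)
    \<le> 2 ^ length xs * (\<rho> * (\<Prod>x\<leftarrow>xs. M x))"
proof -
  have "(\<Sum>n\<in>{1..Y}. interval_conv \<rho> M xs n)
      \<le> (\<Prod>x\<leftarrow>xs. \<Sum>n\<in>{1..Y}. interval_char \<rho> (M x) n)"
    using sum_dconv_list_le[of "map (\<lambda>x. interval_char \<rho> (M x)) xs" Y] interval_char_bounds(1)
    by (fastforce simp: comp_def)
  also have "\<dots> \<le> 2 ^ length xs * interval_size \<rho> (\<Prod>x\<leftarrow>xs. M x)"
    using assms(1-3) by (rule prod_sum_interval_char_le)
  also have "interval_size \<rho> (\<Prod>x\<leftarrow>xs. M x) \<le> \<rho> * (\<Prod>x\<leftarrow>xs. M x)"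
    using assms(4) by (simp add: interval_size_def)
  finally show ?thesis by simp
qed

section \<open>The variance over residue classes\<close>

lemma sum_square_deviation:
  fixes A :: "'a \<Rightarrow> real"
  shows "(\<Sum>a\<in>G. (A a - sum A G / card G)\<^sup>2) = (\<Sum>a\<in>G. (A a)\<^sup>2) - (sum A G)\<^sup>2 / card G"
proof -
  define \<mu> where "\<mu> = sum A G / card G"
  have "(\<Sum>a\<in>G. (A a - \<mu>)\<^sup>2) = (\<Sum>a\<in>G. (A a)\<^sup>2 - 2 * \<mu> * A a + \<mu>\<^sup>2)"
    by (simp add: power2_diff algebra_simps)
  also have "\<dots> = (\<Sum>a\<in>G. (A a)\<^sup>2) - 2 * \<mu> * sum A G + card G * \<mu>\<^sup>2"
    by (simp add: sum.distrib sum_subtractf sum_distrib_left)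
  also have "\<dots> = (\<Sum>a\<in>G. (A a)\<^sup>2) - (sum A G)\<^sup>2 / card G"
    by (cases "card G = 0") (auto simp: \<mu>_def power2_eq_square field_simps)
  finally show ?thesis by (simp add: \<mu>_def)
qed

lemma sum_fibre_squares:
  fixes f :: "'a \<Rightarrow> 'b::comm_semiring_1"
  assumes "finite V" "finite T" "g ` V \<subseteq> T"
  shows "(\<Sum>a\<in>T. (\<Sum>n | n \<in> V \<and> g n = a. f n)\<^sup>2)
    = (\<Sum>n\<in>V. \<Sum>m | m \<in> V \<and> g m = g n. f n * f m)"
proof -
  have "(\<Sum>a\<in>T. (\<Sum>n | n \<in> V \<and> g n = a. f n)\<^sup>2)
      = (\<Sum>a\<in>T. \<Sum>n | n \<in> V \<and> g n = a. \<Sum>m | m \<in> V \<and> g m = g n. f n * f m)"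
    by (intro sum.cong refl) (simp add: power2_eq_square sum_product)
  also have "\<dots> = (\<Sum>n\<in>V. \<Sum>m | m \<in> V \<and> g m = g n. f n * f m)"
    using assms by (rule sum.group)
  finally show ?thesis .
qed

definition least_pos_residue :: "nat \<Rightarrow> nat \<Rightarrow> nat" where
  "least_pos_residue r n = (if r dvd n then r else n mod r)"

lemma least_pos_residue_bounds: "0 < r \<Longrightarrow> least_pos_residue r n \<in> {1..r}"
  by (auto simp: least_pos_residue_def dvd_eq_mod_eq_0 less_imp_le Suc_le_eq)

lemma cong_iff_least_pos_residue:
  assumes "a \<in> {1..r}"
  shows "[n = a] (mod r) \<longleftrightarrow> least_pos_residue r n = a"
proof (cases "a = r")
  case True
  then show ?thesis
    using assms mod_less_divisor[of r n]
    by (auto simp: least_pos_residue_def cong_def dvd_eq_mod_eq_0 simp del: mod_less_divisor)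
next
  case False
  then show ?thesis
    using assms by (auto simp: least_pos_residue_def cong_def dvd_eq_mod_eq_0)
qed

lemma cong_least_pos_residue: "0 < r \<Longrightarrow> [n = least_pos_residue r n] (mod r)"
  by (simp only: cong_iff_least_pos_residue least_pos_residue_bounds)

lemma cong_iff_least_pos_residue_eq:
  assumes "0 < r"
  shows "[n = m] (mod r) \<longleftrightarrow> least_pos_residue r n = least_pos_residue r m"
proof -
  have "[n = m] (mod r) \<longleftrightarrow> [n = least_pos_residue r m] (mod r)"
    using cong_least_pos_residue[OF assms, of m] cong_trans cong_sym by blast
  then show ?thesis
    using least_pos_residue_bounds[OF assms] by (simp only: cong_iff_least_pos_residue)
qed

lemma least_pos_residue_in_totatives:
  assumes "0 < r" "coprime n r"
  shows "least_pos_residue r n \<in> totatives r"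
proof -
  have "coprime (least_pos_residue r n) r"
    using cong_least_pos_residue[OF assms(1)] assms(2) by (rule cong_imp_coprime)
  then show ?thesis
    using least_pos_residue_bounds[OF assms(1), of n] by (simp add: in_totatives_iff)
qed

lemma totatives_eq: "totatives r = {a. a \<in> {1..r} \<and> coprime a r}"
  by (auto simp: totatives_def)

lemma infsum_pos_nat_eq_sum_of_support:
  fixes \<beta> :: "nat \<Rightarrow> real"
  assumes "\<And>n. \<beta> n \<noteq> 0 \<Longrightarrow> n \<in> {1..Y}"
  shows "(\<Sum>\<^sub>\<infinity>n | 0 < n \<and> P n. \<beta> n) = (\<Sum>n | n \<in> {1..Y} \<and> P n. \<beta> n)"
proof -
  have "(\<Sum>\<^sub>\<infinity>n | 0 < n \<and> P n. \<beta> n) = (\<Sum>\<^sub>\<infinity>n | n \<in> {1..Y} \<and> P n. \<beta> n)"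
    using assms by (intro infsum_cong_neutral) force+
  then show ?thesis by simp
qed

definition coprime_upto :: "nat \<Rightarrow> nat \<Rightarrow> nat set" where
  "coprime_upto Y k = {n \<in> {1..Y}. coprime n k}"

lemma finite_coprime_upto: "finite (coprime_upto Y k)"
  by (simp add: coprime_upto_def)

lemma discrepancy_eq_fibre_sum:
  assumes supp: "\<And>n. \<beta> n \<noteq> 0 \<Longrightarrow> n \<in> {1..Y}" and a: "a \<in> totatives r"
  shows "discrepancy \<beta> q r a
    = (\<Sum>n | n \<in> coprime_upto Y (q * r) \<and> least_pos_residue r n = a. \<beta> n)
      - (\<Sum>n\<in>coprime_upto Y (q * r). \<beta> n) / card (totatives r)"
proof -
  have unit: "a \<in> {1..r}" "coprime a r"
    using a by (auto simp: in_totatives_iff)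
  have "{n. n \<in> {1..Y} \<and> [n = a] (mod r) \<and> coprime n q}
      = {n. n \<in> coprime_upto Y (q * r) \<and> least_pos_residue r n = a}"
    using cong_imp_coprime[of a _ r] unit(2)
    by (auto simp: coprime_upto_def cong_sym simp flip: cong_iff_least_pos_residue[OF unit(1)])
  moreover have "(\<Sum>\<^sub>\<infinity>n | 0 < n \<and> P n. \<beta> n) = (\<Sum>n | n \<in> {1..Y} \<and> P n. \<beta> n)" for P
    using supp by (rule infsum_pos_nat_eq_sum_of_support)
  ultimately show ?thesis
    by (simp only: discrepancy_def totient_def coprime_upto_def) simp
qed

lemma sum_discrepancy_squares:
  assumes r: "0 < r" and supp: "\<And>n. \<beta> n \<noteq> 0 \<Longrightarrow> n \<in> {1..Y}"
  shows "(\<Sum>a\<in>totatives r. (discrepancy \<beta> q r a)\<^sup>2)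
    = (\<Sum>n\<in>coprime_upto Y (q * r). \<Sum>m | m \<in> coprime_upto Y (q * r) \<and> [m = n] (mod r). \<beta> n * \<beta> m)
      - (\<Sum>n\<in>coprime_upto Y (q * r). \<beta> n)\<^sup>2 / card (totatives r)"
proof -
  let ?V = "coprime_upto Y (q * r)"
  define A where "A a = (\<Sum>n | n \<in> ?V \<and> least_pos_residue r n = a. \<beta> n)" for a
  have image: "least_pos_residue r ` ?V \<subseteq> totatives r"
    using least_pos_residue_in_totatives[OF r] by (auto simp: coprime_upto_def)
  have mass: "sum A (totatives r) = sum \<beta> ?V"
    unfolding A_def by (rule sum.group[OF finite_coprime_upto finite_totatives image])
  have "(\<Sum>a\<in>totatives r. (discrepancy \<beta> q r a)\<^sup>2)
      = (\<Sum>a\<in>totatives r. (A a - sum A (totatives r) / card (totatives r))\<^sup>2)"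
    unfolding mass A_def
    by (intro sum.cong refl arg_cong[where f = "\<lambda>x. x\<^sup>2"] discrepancy_eq_fibre_sum supp)
  also have "\<dots> = (\<Sum>a\<in>totatives r. (A a)\<^sup>2) - (sum \<beta> ?V)\<^sup>2 / card (totatives r)"
    using sum_square_deviation[of A "totatives r"] by (simp only: mass)
  also have "(\<Sum>a\<in>totatives r. (A a)\<^sup>2) = (\<Sum>n\<in>?V. \<Sum>m | m \<in> ?V \<and> [m = n] (mod r). \<beta> n * \<beta> m)"
    unfolding A_def cong_iff_least_pos_residue_eq[OF r]
    by (rule sum_fibre_squares[OF finite_coprime_upto finite_totatives image])
  finally show ?thesis .
qed

lemma sum_discrepancy_squares_le:
  fixes \<beta> :: "nat \<Rightarrow> real"
  assumes "0 < r" "\<And>n. 0 \<le> \<beta> n" "\<And>n. \<beta> n \<noteq> 0 \<Longrightarrow> n \<in> {1..Y}"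
  shows "(\<Sum>a\<in>totatives r. (discrepancy \<beta> q r a)\<^sup>2)
    \<le> (\<Sum>n\<in>{1..Y}. \<Sum>m | m \<in> {1..Y} \<and> [m = n] (mod r). \<beta> n * \<beta> m)"
proof -
  let ?V = "coprime_upto Y (q * r)"
  have "(\<Sum>a\<in>totatives r. (discrepancy \<beta> q r a)\<^sup>2)
      \<le> (\<Sum>n\<in>?V. \<Sum>m | m \<in> ?V \<and> [m = n] (mod r). \<beta> n * \<beta> m)"
    using sum_discrepancy_squares[OF assms(1,3)] by simp
  also have "\<dots> \<le> (\<Sum>n\<in>?V. \<Sum>m | m \<in> {1..Y} \<and> [m = n] (mod r). \<beta> n * \<beta> m)"
    using assms(2) by (intro sum_mono sum_mono2) (auto simp: coprime_upto_def)
  also have "\<dots> \<le> (\<Sum>n\<in>{1..Y}. \<Sum>m | m \<in> {1..Y} \<and> [m = n] (mod r). \<beta> n * \<beta> m)"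
    using assms(2) by (intro sum_mono2 sum_nonneg) (auto simp: coprime_upto_def)
  finally show ?thesis .
qed

section \<open>Averaging over moduli\<close>

definition dispersion :: "nat set \<Rightarrow> (nat \<Rightarrow> real) \<Rightarrow> nat \<Rightarrow> real" where
  "dispersion Q \<beta> q = (\<Sum>r\<in>Q. \<Sum>a\<in>totatives r. (discrepancy \<beta> q r a)\<^sup>2)"

lemma card_moduli_cong_le_divisor_tau:
  assumes "m \<noteq> n"
  shows "card {r \<in> Q. [m = n] (mod r)} \<le> divisor_tau (nat \<bar>int m - int n\<bar>)"
  unfolding divisor_tau_def using assms
  by (intro card_mono finite_divisors_nat) (auto simp: cong_altdef_nat')

lemma congruent_pairs_le:
  fixes \<beta> :: "nat \<Rightarrow> real"
  assumes "finite Q" "\<And>n. 0 \<le> \<beta> n" "\<And>n. n \<in> {1..Y} \<Longrightarrow> \<beta> n \<le> E"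
    and tau_le: "\<And>n. n \<in> {1..Y} \<Longrightarrow> real (divisor_tau n) \<le> E"
    and n: "n \<in> {1..Y}" and m: "m \<in> {1..Y}"
  shows "\<beta> n * \<beta> m * real (card {r \<in> Q. [m = n] (mod r)})
    \<le> E * ((if m = n then real (card Q) * \<beta> n else 0) + \<beta> n * \<beta> m)"
proof (cases "m = n")
  case True
  have E: "0 \<le> E" "\<beta> n \<le> E"
    using assms(2,3)[of n] n by auto
  have "\<beta> n * (\<beta> n * real (card Q)) \<le> E * (\<beta> n * real (card Q))"
    using E assms(2) by (intro mult_right_mono) auto
  moreover have "0 \<le> E * (\<beta> n * \<beta> n)"
    using E by simp
  ultimately show ?thesis
    using True by (simp add: algebra_simps)
next
  case False
  have "real (card {r \<in> Q. [m = n] (mod r)}) \<le> real (divisor_tau (nat \<bar>int m - int n\<bar>))"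
    using card_moduli_cong_le_divisor_tau[OF False] by simp
  also have "\<dots> \<le> E"
    using False n m by (intro tau_le) auto
  finally have "\<beta> n * \<beta> m * real (card {r \<in> Q. [m = n] (mod r)}) \<le> \<beta> n * \<beta> m * E"
    using assms(2) by (intro mult_left_mono) auto
  then show ?thesis
    using False by (simp add: mult_ac)
qed

lemma dispersion_le:
  fixes \<beta> :: "nat \<Rightarrow> real"
  assumes "finite Q" "0 \<notin> Q" "\<And>n. 0 \<le> \<beta> n" "\<And>n. \<beta> n \<noteq> 0 \<Longrightarrow> n \<in> {1..Y}"
    and "\<And>n. n \<in> {1..Y} \<Longrightarrow> \<beta> n \<le> E" "\<And>n. n \<in> {1..Y} \<Longrightarrow> real (divisor_tau n) \<le> E"
  shows "dispersion Q \<beta> q \<le> E * (card Q * (\<Sum>n\<in>{1..Y}. \<beta> n) + (\<Sum>n\<in>{1..Y}. \<beta> n)\<^sup>2)"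
proof -
  have "dispersion Q \<beta> q
      \<le> (\<Sum>r\<in>Q. \<Sum>n\<in>{1..Y}. \<Sum>m | m \<in> {1..Y} \<and> [m = n] (mod r). \<beta> n * \<beta> m)"
    unfolding dispersion_def
  proof (intro sum_mono sum_discrepancy_squares_le assms(3,4))
    show "0 < r" if "r \<in> Q" for r
      using that assms(2) by (cases r) auto
  qed
  also have "\<dots> = (\<Sum>n\<in>{1..Y}. \<Sum>m\<in>{1..Y}. \<Sum>r | r \<in> Q \<and> [m = n] (mod r). \<beta> n * \<beta> m)"
    by (subst sum.swap) (simp only: sum.swap_restrict[OF assms(1)] finite_atLeastAtMost)
  also have "\<dots> = (\<Sum>n\<in>{1..Y}. \<Sum>m\<in>{1..Y}. \<beta> n * \<beta> m * card {r \<in> Q. [m = n] (mod r)})"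
    by (simp add: mult_ac)
  also have "\<dots> \<le> (\<Sum>n\<in>{1..Y}. \<Sum>m\<in>{1..Y}.
      E * ((if m = n then card Q * \<beta> n else 0) + \<beta> n * \<beta> m))"
    using assms by (intro sum_mono congruent_pairs_le)
  also have "\<dots> = E * (card Q * (\<Sum>n\<in>{1..Y}. \<beta> n) + (\<Sum>n\<in>{1..Y}. \<beta> n)\<^sup>2)"
    by (simp add: sum.distrib power2_eq_square sum_product flip: sum_distrib_left)
  finally show ?thesis .
qed

lemma finite_dyadic: "finite (dyadic R)"
  by (rule finite_subset[OF _ finite_nat_real_less[of "2 * R"]]) (auto simp: dyadic_def)

lemma zero_notin_dyadic: "0 \<notin> dyadic R"
  by (auto simp: dyadic_def)

lemma card_dyadic_le: "real (card (dyadic R)) \<le> 2 * max 0 R"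
proof (cases "0 < R")
  case True
  have "card (dyadic R) \<le> card {n::nat. 0 < n \<and> real n < 2 * R}"
  proof (rule card_mono)
    show "finite {n::nat. 0 < n \<and> real n < 2 * R}"
      by (rule finite_subset[OF _ finite_nat_real_less[of "2 * R"]]) auto
    show "dyadic R \<subseteq> {n. 0 < n \<and> real n < 2 * R}"
      using True by (auto simp: dyadic_def intro: gr0I)
  qed
  then show ?thesis
    using card_pos_nat_less_le[of "2 * R"] True by simp
next
  case False
  then have "dyadic R = {}"
    by (auto simp: dyadic_def)
  then show ?thesis by simp
qed

lemma dispersion_dyadic_le:
  fixes \<beta> :: "nat \<Rightarrow> real"
  assumes "0 \<le> E" "\<And>n. 0 \<le> \<beta> n" "\<And>n. \<beta> n \<noteq> 0 \<Longrightarrow> n \<in> {1..Y}"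
    and "\<And>n. n \<in> {1..Y} \<Longrightarrow> \<beta> n \<le> E" "\<And>n. n \<in> {1..Y} \<Longrightarrow> real (divisor_tau n) \<le> E"
    and "(\<Sum>n\<in>{1..Y}. \<beta> n) \<le> S"
  shows "dispersion (dyadic R) \<beta> q \<le> E * (2 * max 0 R * S + S\<^sup>2)"
proof -
  have "0 \<le> (\<Sum>n\<in>{1..Y}. \<beta> n)"
    using assms(2) by (rule sum_nonneg)
  moreover have "dispersion (dyadic R) \<beta> q
      \<le> E * (card (dyadic R) * (\<Sum>n\<in>{1..Y}. \<beta> n) + (\<Sum>n\<in>{1..Y}. \<beta> n)\<^sup>2)"
    using finite_dyadic zero_notin_dyadic assms(2-5) by (rule dispersion_le)
  moreover have "\<dots> \<le> E * (2 * max 0 R * S + S\<^sup>2)"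
    using card_dyadic_le assms(1,6) calculation(1)
    by (intro mult_left_mono add_mono mult_mono power_mono) auto
  ultimately show ?thesis by linarith
qed

section \<open>The dispersion of convolutions of short intervals\<close>

lemma dispersion_interval_conv_le:
  fixes M :: "'a \<Rightarrow> real" and xs :: "'a list" and \<rho> N :: real
  assumes M: "\<And>x. x \<in> set xs \<Longrightarrow> 0 < M x" and N: "N = (\<Prod>x\<leftarrow>xs. M x)" and "xs \<noteq> []"
    and \<rho>: "0 \<le> \<rho>" "\<rho> \<le> 1" "1 \<le> \<rho> * N"
    and tau_le: "\<And>n. 0 < n \<Longrightarrow> real n \<le> 2 ^ length xs * N \<Longrightarrow> real (divisor_tau n) ^ length xs \<le> E"
  shows "dispersion (dyadic R) (interval_conv \<rho> M xs) q
    \<le> E * 4 ^ length xs * (\<rho> * N * (2 * max 0 R + \<rho> * N))"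
proof -
  define Y where "Y = nat \<lfloor>2 ^ length xs * N\<rfloor>"
  define S where "S = 2 ^ length xs * (\<rho> * N)"
  have "0 \<le> N"
    unfolding N using M by (intro prod_list_nonneg) (auto intro: less_imp_le)
  then have "1 \<le> N"
    using \<rho> mult_right_mono[of \<rho> 1 N] by simp
  then have E: "0 \<le> E"
    by (intro order_trans[OF _ tau_le[of 1]]) (auto simp: mult_ge1_I)
  have tau_power_le: "real (divisor_tau n) ^ length xs \<le> E" if "n \<in> {1..Y}" for n
    using that \<open>0 \<le> N\<close> by (intro tau_le) (auto simp: Y_def le_nat_iff le_floor_iff)
  have "dispersion (dyadic R) (interval_conv \<rho> M xs) q \<le> E * (2 * max 0 R * S + S\<^sup>2)"
  proof (rule dispersion_dyadic_le[where Y = Y])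
    show "n \<in> {1..Y}" if "interval_conv \<rho> M xs n \<noteq> 0" for n
      using interval_conv_support[OF M \<rho>(2) that] by (simp add: Y_def N)
    show "interval_conv \<rho> M xs n \<le> E" if "n \<in> {1..Y}" for n
      using interval_conv_le_divisor_tau_power[of n \<rho> M xs] tau_power_le[OF that] that by simp
    show "real (divisor_tau n) \<le> E" if "n \<in> {1..Y}" for n
      using order_trans[OF self_le_power tau_power_le[OF that]] divisor_tau_pos[of n] that
        \<open>xs \<noteq> []\<close> by (simp add: Suc_le_eq)
    show "(\<Sum>n\<in>{1..Y}. interval_conv \<rho> M xs n) \<le> S"
      unfolding S_def N using M \<rho> N by (intro sum_interval_conv_le) auto
  qed (rule E interval_conv_nonneg)+
  also have "\<dots> \<le> E * (2 * max 0 R * (4 ^ length xs * (\<rho> * N)) + 4 ^ length xs * (\<rho> * N)\<^sup>2)"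
  proof (intro mult_left_mono add_mono)
    show "S \<le> 4 ^ length xs * (\<rho> * N)"
      unfolding S_def using \<rho> by (intro mult_right_mono power_mono) auto
    have "(2 ^ length xs)\<^sup>2 = (4::real) ^ length xs"
      by (simp add: power2_eq_square flip: power_mult_distrib)
    then show "S\<^sup>2 \<le> 4 ^ length xs * (\<rho> * N)\<^sup>2"
      by (simp add: S_def power_mult_distrib)
  qed (use E in auto)
  finally show ?thesis by (simp add: algebra_simps power2_eq_square)
qed

lemma mult_powr_le:
  fixes x :: real
  assumes "0 \<le> c" "0 \<le> \<omega>" "0 \<le> x" "0 \<le> a" "x \<le> a * X powr \<kappa>"
  shows "c * x powr \<omega> \<le> c * a powr \<omega> * X powr (\<kappa> * \<omega>)"
proof -
  have "x powr \<omega> \<le> (a * X powr \<kappa>) powr \<omega>"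
    using assms by (intro powr_mono2)
  also have "\<dots> = a powr \<omega> * X powr (\<kappa> * \<omega>)"
    using assms(4) by (simp add: powr_mult powr_powr)
  finally show ?thesis
    using assms(1) by (simp add: mult.assoc mult_left_mono)
qed

text \<open>The exponent collects \<open>\<omega>/2\<close> from the divisor bound, \<open>-\<omega>\<close> from the mass of the convolution and
  \<open>-\<theta>\<close> from the range of the moduli.\<close>

lemma dispersion_interval_conv_power_saving:
  fixes M :: "'a \<Rightarrow> real" and xs :: "'a list" and X \<omega> \<theta> c K N R :: real
  assumes "0 < \<omega>" "\<theta> \<le> \<omega>" "0 \<le> c" "0 \<le> K" "1 \<le> X" "xs \<noteq> []"
    and tau_power_le: "\<And>n. 0 < n \<Longrightarrow> real (divisor_tau n) ^ length xs \<le> c * n powr \<omega>"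
    and M: "\<And>x. x \<in> set xs \<Longrightarrow> 0 < M x" "N = (\<Prod>x\<leftarrow>xs. M x)"
    and N: "X powr \<omega> \<le> N" "N \<le> K * X powr (1/2)" and R: "R \<le> X powr (-\<theta>) * N"
  shows "dispersion (dyadic R) (interval_conv (X powr (-\<omega>)) M xs) q
    \<le> c * (2 ^ length xs * K) powr \<omega> * (3 * 4 ^ length xs) * (N\<^sup>2 * X powr (-\<omega>/2 - \<theta>))"
proof -
  let ?L = "length xs"
  define \<rho> where "\<rho> = X powr (-\<omega>)"
  define T where "T = X powr (-\<theta>) * N"
  define D where "D = c * (2 ^ ?L * K) powr \<omega>"
  have \<rho>: "0 \<le> \<rho>" "\<rho> \<le> 1" "1 \<le> \<rho> * N"
    using assms(1,5) mult_left_mono[OF N(1), of \<rho>] powr_mono[of "-\<omega>" 0 X]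
    by (auto simp: \<rho>_def simp flip: powr_add)
  have "0 < N"
    using assms(5) by (intro less_le_trans[OF _ N(1)]) auto
  then have "\<rho> * N \<le> T" "0 \<le> T"
    using assms(2,5) by (auto simp: T_def \<rho>_def intro!: mult_right_mono powr_mono)
  have tau_le: "real (divisor_tau n) ^ ?L \<le> D * X powr (\<omega>/2)"
    if "0 < n" "real n \<le> 2 ^ ?L * N" for n
  proof -
    have "real n \<le> (2 ^ ?L * K) * X powr (1/2)"
      using order_trans[OF that(2) mult_left_mono[OF N(2)]] by (simp add: mult.assoc)
    then have "c * real n powr \<omega> \<le> D * X powr (1/2 * \<omega>)"
      unfolding D_def using assms(1,3,4) by (intro mult_powr_le) auto
    then show ?thesis
      using tau_power_le[OF that(1)] by simp
  qed
  have "dispersion (dyadic R) (interval_conv \<rho> M xs) q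
      \<le> D * X powr (\<omega>/2) * 4 ^ ?L * (\<rho> * N * (2 * max 0 R + \<rho> * N))"
    using M \<open>xs \<noteq> []\<close> \<rho> tau_le by (rule dispersion_interval_conv_le)
  also have "\<dots> \<le> D * X powr (\<omega>/2) * 4 ^ ?L * (\<rho> * N * (3 * T))"
  proof (intro mult_left_mono)
    show "2 * max 0 R + \<rho> * N \<le> 3 * T"
      using R \<open>\<rho> * N \<le> T\<close> \<open>0 \<le> T\<close> by (simp flip: T_def)
  qed (use \<rho> assms(3) in \<open>auto simp: D_def\<close>)
  also have "\<dots> = D * (3 * 4 ^ ?L) * (N\<^sup>2 * X powr (\<omega>/2 + (-\<omega>) + (-\<theta>)))"
    by (simp only: T_def \<rho>_def powr_add power2_eq_square mult_ac)
  also have "\<omega>/2 + (-\<omega>) + (-\<theta>) = -\<omega>/2 - \<theta>"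
    by simp
  finally show ?thesis
    by (simp only: \<rho>_def D_def)
qed

lemma varpi_pos: "0 < varpi"
  by (simp add: varpi_def)

theorem lemma3p9:
  "\<exists>B::real. 0 < B \<and>
    (\<forall>(L::nat) (K::real). 1 \<le> L \<longrightarrow> 0 < K \<longrightarrow>
      (\<exists>(C::real) (X0::real). 0 < C \<and> 1 \<le> X0 \<and>
        (\<forall>(X::real) (\<rho>::real) (Nj::nat \<Rightarrow> real) (js::nat list) (N::real) (\<beta>::nat \<Rightarrow> real) (R::real) (q::nat).
          X0 \<le> X \<longrightarrow>
          \<rho> = X powr (-varpi) \<longrightarrow>
          length js = L \<longrightarrow>
          (\<forall>j\<in>set js. 0 < Nj j) \<longrightarrow>
          N = (\<Prod>j\<leftarrow>js. Nj j) \<longrightarrow>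
          \<beta> = dconv_list (map (\<lambda>j. interval_char \<rho> (Nj j)) js) \<longrightarrow>
          X powr (3/8 + 8 * varpi) < N \<longrightarrow>
          N \<le> K * X powr (1/2) \<longrightarrow>
          R \<le> X powr (-varpi/6) * N \<longrightarrow>
          1 \<le> q \<longrightarrow>
          (\<Sum>r\<in>dyadic R. \<Sum>a | a \<in> {1..r} \<and> coprime a r. (discrepancy \<beta> q r a)\<^sup>2)
            \<le> C * (real (divisor_tau q) powr B * N\<^sup>2 * X powr (-varpi/12)))))"
    (is "\<exists>B. 0 < B \<and> (\<forall>L K. 1 \<le> L \<longrightarrow> 0 < K \<longrightarrow> ?bounded B L K)")
proof (rule exI[of _ 1], intro conjI allI impI)
  fix L :: nat and K :: real
  assume L: "1 \<le> L" and K: "0 < K"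
  obtain c where c: "0 < c" "\<And>n. 0 < n \<Longrightarrow> real (divisor_tau n) ^ L \<le> c * n powr varpi"
    using divisor_tau_power_bound[of varpi L] L by (auto simp: varpi_pos)
  let ?C = "c * (2 ^ L * K) powr varpi * (3 * 4 ^ L)"
  show "?bounded 1 L K"
  proof (rule exI[of _ ?C], rule exI[of _ 1], intro conjI allI impI)
    fix X \<rho> N R :: real and Nj :: "nat \<Rightarrow> real" and js \<beta> and q :: nat
    assume X: "1 \<le> X" and q: "1 \<le> q" and R: "R \<le> X powr (-varpi/6) * N"
      and js: "length js = L" "\<forall>j\<in>set js. 0 < Nj j" "N = (\<Prod>j\<leftarrow>js. Nj j)"
      and \<beta>: "\<rho> = X powr (-varpi)" "\<beta> = interval_conv \<rho> Nj js"
      and N: "X powr (3/8 + 8 * varpi) < N" "N \<le> K * X powr (1/2)"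
    have "X powr varpi \<le> N"
      using X N(1) powr_mono[of varpi "3/8 + 8 * varpi" X] by (simp add: varpi_def)
    then have "dispersion (dyadic R) \<beta> q \<le> ?C * (N\<^sup>2 * X powr (-varpi/2 - varpi/6))"
      using dispersion_interval_conv_power_saving[of varpi "varpi/6" c K X js Nj N R q]
        X L K N R c js \<beta> by (auto simp: varpi_pos Suc_le_eq)
    also have "\<dots> \<le> ?C * (divisor_tau q powr 1 * N\<^sup>2 * X powr (-varpi/12))"
      using c K X divisor_tau_pos[of q] q
      by (intro mult_left_mono mult_mono powr_mono) (auto simp: varpi_def mult_le_cancel_right1)
    finally show "(\<Sum>r\<in>dyadic R. \<Sum>a | a \<in> {1..r} \<and> coprime a r. (discrepancy \<beta> q r a)\<^sup>2)
        \<le> ?C * (divisor_tau q powr 1 * N\<^sup>2 * X powr (-varpi/12))"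
      by (simp only: dispersion_def totatives_eq)
  qed (use c K in simp_all)
qed simp

end
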